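(* Let $\Omega=\{\omega_1,\dots,\omega_k\}\subseteq\mathbb{Q}^n$ and let $\theta\in\mathbb{Q}^n$ lie in the relative interior of $\operatorname{conv}\Omega$. Then $$\log_2\frac1{r_\theta}\le6n^2\max_{i\in[k]}\langle\omega_i\rangle+\langle\theta\rangle-n.$$ If $\theta=0$, the upper bound can be improved to $3n^2\max_{i\in[k]}\langle\omega_i\rangle-n$.
   Context: $r_\theta=\max\{r\ge 0: B(\theta,r)\cap\operatorname{aff}\Omega\subseteq\operatorname{conv}\Omega\}$ is the Euclidean distance from $\theta$ to the relative boundary of $\operatorname{conv}\Omega$ ($B$ = closed Euclidean ball, $\operatorname{aff}$ = affine hull); $\Omega$ is assumed to contain at least two points so that $r_\theta$ is well-defined. $\langle\cdot\rangle$ is the binary encoding length in the convention of Grötschel–Lovász–Schrijver: $\langle m\rangle=1+\lceil\log_2(|m|+1)\rceil$ for an integer $m$; $\langle p/s\rangle=\langle p\rangle+\langle s\rangle$ for coprime integers $p,s$ with $s>0$; $\langle v\rangle=n+\sum_{j=1}^n\langle v_j\rangle$ for $v\in\mathbb{Q}^n$. *)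

theory Defs
  imports "HOL-Analysis.Analysis"
begin

text \<open>Binary encoding lengths in the convention of Groetschel, Lovasz and Schrijver.\<close>

definition enc_int :: "int \<Rightarrow> int" where
  "enc_int m = 1 + \<lceil>log 2 (real_of_int (\<bar>m\<bar> + 1))\<rceil>"

text \<open>\<^const>\<open>quotient_of\<close> returns the representation \<open>p / s\<close> with \<open>p\<close>, \<open>s\<close> coprime and
  \<open>s > 0\<close>. An integer, as a rational number, is \<open>p / 1\<close>; its denominator contributes
  \<open>enc_int 1 = 2\<close>.\<close>

definition enc_rat :: "rat \<Rightarrow> int" where
  "enc_rat q = (case quotient_of q of (p, s) \<Rightarrow> enc_int p + enc_int s)"

definition enc_vec :: "rat ^ 'n \<Rightarrow> int" where
  "enc_vec v = int CARD('n) + (\<Sum>j\<in>UNIV. enc_rat (v $ j))"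

definition real_vec :: "rat ^ 'n \<Rightarrow> real ^ 'n" where
  "real_vec v = (\<chi> j. of_rat (v $ j))"

text \<open>The maximum exists whenever \<open>\<Omega>\<close> is finite with at least two points and
  \<open>\<theta> \<in> convex hull \<Omega>\<close>. For a one-point set there is none, since every radius is admissible.\<close>

definition rel_radius :: "'a::euclidean_space set \<Rightarrow> 'a \<Rightarrow> real" where
  "rel_radius \<Omega> \<theta> =
     (GREATEST r. 0 \<le> r \<and> cball \<theta> r \<inter> affine hull \<Omega> \<subseteq> convex hull \<Omega>)"

end

(* A closest relative boundary point y lies in a facet of conv Omega, i.e. in the affine hull of
   some V <= Omega that misses theta. Take u in V and form a matrix with rows theta - u, a basis
   of the span of the v - u (v in V), and unit vectors completing these to a basis of the whole
   space. After clearing denominators its determinant is a nonzero integer, hence at least 1 in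
   absolute value. Replacing theta - u by theta - y does not change the determinant, which is
   thus at most |theta - y| times a product of row norms controlled by the encoding lengths.
   Clearing the denominator of theta costs a single factor, absent for theta = 0, and the rest
   already fits into 3 n^2 phi - n. *)

theory Submission
  imports Defs
begin

section \<open>Determinant bounds and an elementary product inequality\<close>

text \<open>Enlarging the index set of the Leibniz expansion from permutations to all maps makes it
  factor into the l1 norms of the rows. A Hadamard-type bound with l1 norms, which encoding lengths
  control directly.\<close>

lemma abs_det_le_prod_sum_abs:
  fixes A :: "real^'n^'n"
  shows "\<bar>det A\<bar> \<le> (\<Prod>i\<in>UNIV. \<Sum>j\<in>UNIV. \<bar>A $ i $ j\<bar>)"
proof -
  have "\<bar>det A\<bar> \<le> (\<Sum>p\<in>{p. p permutes (UNIV :: 'n set)}. \<Prod>i\<in>UNIV. \<bar>A $ i $ p i\<bar>)"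
    unfolding det_def
    by (rule order_trans[OF sum_abs]) (auto simp: abs_mult abs_prod sign_def intro!: sum_mono)
  also have "\<dots> \<le> (\<Sum>g\<in>UNIV \<rightarrow>\<^sub>E UNIV. \<Prod>i\<in>UNIV. \<bar>A $ i $ g i\<bar>)"
    by (rule sum_mono2) (auto intro: prod_nonneg)
  also have "\<dots> = (\<Prod>i\<in>UNIV. \<Sum>j\<in>UNIV. \<bar>A $ i $ j\<bar>)"
    by (simp add: prod_sum_PiE)
  finally show ?thesis .
qed

lemma det_Ints:
  fixes A :: "real^'n^'n"
  assumes "\<And>i j. A $ i $ j \<in> \<int>"
  shows "det A \<in> \<int>"
  unfolding det_def by (intro Ints_sum Ints_mult Ints_prod Ints_of_int assms)

lemma det_nonzero_if_span_rows:
  fixes A :: "real^'n^'n"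
  assumes "span (rows A) = UNIV"
  shows "det A \<noteq> 0"
  using assms invertible_det_nz[of A]
  by (simp add: invertible_left_inverse matrix_left_invertible_span_rows)

text \<open>Expanding the product yields the left-hand side plus nonnegative terms. It later splits
  one plus an l1 norm into one factor per coordinate, matching the additive encoding length.\<close>

lemma one_plus_sum_le_prod:
  fixes f :: "'a \<Rightarrow> real"
  assumes "\<And>i. i \<in> A \<Longrightarrow> 0 \<le> f i"
  shows "1 + sum f A \<le> (\<Prod>i\<in>A. 1 + f i)"
  using assms
proof (induction A rule: infinite_finite_induct)
  case (insert a A)
  have "1 \<le> (\<Prod>i\<in>A. 1 + f i)"
    using insert.prems by (intro prod_ge_1) simp
  then have "f a * 1 \<le> f a * (\<Prod>i\<in>A. 1 + f i)"
    using insert.prems by (intro mult_left_mono) auto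
  then show ?case
    using insert by (simp add: distrib_right)
qed simp_all

section \<open>Nearest relative boundary points and the facets containing them\<close>

text \<open>The relative boundary is closed and nonempty, so some \<open>y\<close> on it is nearest
  to \<open>x\<close>. Rays from \<open>x\<close> stay in the polytope at least up to that distance,
  and a larger ball would make \<open>y\<close> a relative interior point; hence the
  \<open>GREATEST\<close> is attained.\<close>

lemma rel_radius_eq_dist_rel_frontier:
  fixes S :: "'a::euclidean_space set"
  assumes "finite S" and "2 \<le> card S"
    and x: "x \<in> rel_interior (convex hull S)"
  obtains y where "y \<in> rel_frontier (convex hull S)" "rel_radius S x = dist x y"
proof -
  let ?P = "convex hull S"
  have cpt: "compact ?P"
    using \<open>finite S\<close> by (simp add: finite_imp_compact_convex_hull)
  have bdd: "bounded ?P"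
    using cpt by (rule compact_imp_bounded)
  have "rel_frontier ?P \<noteq> {}"
  proof
    assume "rel_frontier ?P = {}"
    then have "affine ?P" by (simp add: rel_frontier_eq_empty)
    \<comment> \<open>A bounded affine set is empty or a single point, which two distinct points in
      \<open>S\<close> exclude.\<close>
    then obtain a where "?P = {a}"
      using affine_bounded_eq_trivial[of ?P] bdd x rel_interior_subset[of ?P] by auto
    then have "S \<subseteq> {a}" using hull_subset[of S convex] by auto
    then have "card S \<le> 1" using card_mono[of "{a}" S] by simp
    then show False using assms(2) by simp
  qed
  then obtain y where y: "y \<in> rel_frontier ?P"
    and min: "\<And>z. z \<in> rel_frontier ?P \<Longrightarrow> dist x y \<le> dist x z"
    using distance_attains_inf[of "rel_frontier ?P" x] closed_rel_frontier by blast
  have fr: "rel_frontier ?P \<subseteq> ?P"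
    using cpt by (simp add: rel_frontier_def compact_imp_closed)
  have sub: "cball x (dist x y) \<inter> affine hull S \<subseteq> ?P"
  proof
    fix z assume z: "z \<in> cball x (dist x y) \<inter> affine hull S"
    show "z \<in> ?P"
    proof (cases "z = x")
      case True
      then show ?thesis using x rel_interior_subset by blast
    next
      case False
      then obtain d where d: "0 < d" "x + d *\<^sub>R (z - x) \<in> rel_frontier ?P"
        "\<And>e. \<lbrakk>0 \<le> e; e < d\<rbrakk> \<Longrightarrow> x + e *\<^sub>R (z - x) \<in> rel_interior ?P"
        using ray_to_rel_frontier[OF bdd x, of "z - x"] z by auto
      \<comment> \<open>The ray through \<open>z\<close> meets the relative boundary at parameter
        \<open>d\<close>, no nearer to \<open>x\<close> than \<open>y\<close>. So \<open>d\<close>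
        is at least 1, and \<open>z\<close>, at parameter 1, has not yet left the polytope.\<close>
      have "dist x y \<le> d * dist x z"
        using min[OF d(2)] d(1) by (simp add: dist_norm norm_minus_commute)
      moreover have "dist x z \<le> dist x y" using z by simp
      ultimately have "1 * dist x z \<le> d * dist x z" by linarith
      then have "1 \<le> d" using False by simp
      then show ?thesis
        using d(2) d(3)[of 1] fr rel_interior_subset[of ?P] by (cases "d = 1") auto
    qed
  qed
  have "rel_radius S x = dist x y"
    unfolding rel_radius_def
  proof (rule Greatest_equality)
    show "0 \<le> dist x y \<and> cball x (dist x y) \<inter> affine hull S \<subseteq> ?P"
      using sub by simp
    fix r assume r: "0 \<le> r \<and> cball x r \<inter> affine hull S \<subseteq> ?P"
    show "r \<le> dist x y"
    proof (rule ccontr)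
      assume "\<not> r \<le> dist x y"
      then have "y \<in> ball x r" by simp
      moreover have "ball x r \<inter> affine hull ?P \<subseteq> ?P"
        using r ball_subset_cball[of x r] by auto
      ultimately have "y \<in> rel_interior ?P"
        using y fr by (subst mem_rel_interior) (blast intro: open_ball)
      then show False using y by (simp add: rel_frontier_def)
    qed
  qed
  then show thesis using y that by blast
qed

text \<open>The relative boundary of a polytope is the union of its facets, and each facet is the
  hull of some of the points of \<open>S\<close>. A face is the intersection of the polytope with
  the affine hull of the face, and a proper face misses the relative interior, so \<open>x\<close>
  is outside that affine hull.\<close>

lemma rel_frontier_convex_hull_finite:
  fixes S :: "'a::euclidean_space set"
  assumes "finite S" and y: "y \<in> rel_frontier (convex hull S)"
    and x: "x \<in> rel_interior (convex hull S)"
  obtains V where "V \<subseteq> S" "y \<in> affine hull V" "x \<notin> affine hull V"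
proof -
  let ?P = "convex hull S"
  obtain F where F: "F facet_of ?P" "y \<in> F"
    using y \<open>finite S\<close> by (auto simp: rel_frontier_of_polyhedron polyhedron_convex_hull)
  then have face: "F face_of ?P" and ne: "F \<noteq> ?P"
    by (auto simp: facet_of_imp_face_of facet_of_irrefl)
  obtain V where V: "V \<subseteq> S" "F = convex hull V"
    using face_of_convex_hull_subset[OF finite_imp_compact[OF \<open>finite S\<close>] face] by blast
  have "x \<notin> affine hull F"
    using face_of_imp_eq_affine_Int[OF convex_convex_hull face]
      face_of_disjoint_rel_interior[OF face ne] x rel_interior_subset[of ?P] by blast
  moreover have "y \<in> affine hull F" using F(2) by (rule hull_inc)
  ultimately show thesis using V that by simp
qed

section \<open>Lower bound for the distance to an affine hull\<close>

text \<open>Here \<open>c v\<close> is a common denominator of \<open>v\<close>; the summand 1 in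
  \<open>c_bound\<close> lets \<open>K\<close> bound both \<open>c v\<close> and the cleared l1
  norm. On the right, \<open>c x * K\<close> pays for clearing \<open>x - u\<close>,
  \<open>n * dist x y\<close> (with \<open>n\<close> the dimension) bounds the l1 norm of
  \<open>x - y\<close>, and each other row costs at most \<open>2 * K\<^sup>2\<close>.\<close>

lemma dist_affine_hull_lower_bound:
  fixes x y :: "real^'n" and V :: "(real^'n) set" and c :: "real^'n \<Rightarrow> real"
  assumes y: "y \<in> affine hull V" and x: "x \<notin> affine hull V"
    and c_pos: "\<And>v. v \<in> insert x V \<Longrightarrow> 1 \<le> c v"
    and c_Ints: "\<And>v. v \<in> insert x V \<Longrightarrow> c v \<in> \<int>"
    and c_mult_Ints: "\<And>v j. v \<in> insert x V \<Longrightarrow> c v * v $ j \<in> \<int>"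
    and c_bound: "\<And>v. v \<in> V \<Longrightarrow> c v * (1 + (\<Sum>j\<in>UNIV. \<bar>v $ j\<bar>)) \<le> K"
  shows "1 \<le> c x * K * (real CARD('n) * dist x y) * (2 * K\<^sup>2) ^ (CARD('n) - 1)"
proof -
  obtain u where u: "u \<in> V" using y by fastforce
  have c_le_K: "c v \<le> K" and c_sum_le: "c v * (\<Sum>j\<in>UNIV. \<bar>v $ j\<bar>) \<le> K" if "v \<in> V" for v
  proof -
    have "1 \<le> c v" using c_pos that by simp
    moreover from this have "0 \<le> c v * (\<Sum>j\<in>UNIV. \<bar>v $ j\<bar>)"
      by (intro mult_nonneg_nonneg sum_nonneg) auto
    ultimately show "c v \<le> K" and "c v * (\<Sum>j\<in>UNIV. \<bar>v $ j\<bar>) \<le> K"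
      using c_bound[OF that] unfolding distrib_left by linarith+
  qed
  have K: "1 \<le> K" using c_le_K[OF u] c_pos[of u] u by simp
  define T where "T = (\<lambda>v. - u + v) ` V"
  have aff: "affine hull V = (\<lambda>v. u + v) ` span T"
    unfolding T_def using u by (intro affine_hull_span_gen hull_inc)
  obtain W where W: "W \<subseteq> T" "independent W" "T \<subseteq> span W"
    using maximal_independent_subset by blast
  have span_T: "span T = span W"
    using W by (meson span_mono span_span subset_antisym span_minimal subspace_span)
  \<comment> \<open>Translating by \<open>-u\<close> turns the affine hull into the span of
    \<open>W\<close>: \<open>t\<close> lies outside it, \<open>u - y\<close> inside.\<close>
  define t where "t = x - u"
  have t: "t \<notin> span W"
    using x unfolding aff span_T t_def by (auto simp: image_iff)
  have uy: "u - y \<in> span W"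
    using y unfolding aff span_T by (auto simp: span_neg)
  have "independent (insert t W)"
    using t W(2) by (simp add: independent_insert)
  then obtain B where B: "insert t W \<subseteq> B" "B \<subseteq> insert t W \<union> Basis" "independent B"
    "insert t W \<union> Basis \<subseteq> span B"
    using maximal_independent_subset_extend[of "insert t W" "insert t W \<union> Basis"] by blast
  have span_B: "span B = UNIV"
    using B(4) span_Basis span_minimal[of Basis "span B"] by auto
  have finB: "finite B" and cardB: "card B = CARD('n)"
    using B(3) independent_imp_finite span_B dim_eq_card_independent[OF B(3)]
      dim_span[of B] by auto
  obtain g :: "'n \<Rightarrow> real^'n" where g: "bij_betw g UNIV B"
    using finite_same_card_bij[of "UNIV :: 'n set" B] finB cardB by auto
  obtain i0 where i0: "g i0 = t"
    using g B(1) unfolding bij_betw_def by auto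
  have gne: "g i \<in> B - {t}" if "i \<noteq> i0" for i
    using g i0 that unfolding bij_betw_def inj_def by auto
  \<comment> \<open>Every row other than \<open>t\<close> gets a multiplier making it integral at
    bounded cost: \<open>c u * c v\<close> for a difference \<open>v - u\<close>, and 1 for a unit
    vector.\<close>
  have "\<exists>d>0. (\<forall>j. d * b $ j \<in> \<int>) \<and> d * (\<Sum>j\<in>UNIV. \<bar>b $ j\<bar>) \<le> 2 * K\<^sup>2"
    if "b \<in> B - {t}" for b
  proof (cases "b \<in> W")
    case True
    then obtain v where v: "v \<in> V" "b = v - u" using W(1) by (auto simp: T_def)
    have cc: "1 \<le> c u" "1 \<le> c v" using c_pos u v by auto
    have "c u * c v * b $ j \<in> \<int>" for j
    proof -
      have "c u * c v * b $ j = c u * (c v * v $ j) - c v * (c u * u $ j)"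
        by (simp add: v algebra_simps)
      then show ?thesis
        using c_Ints c_mult_Ints u v by (simp add: Ints_diff Ints_mult)
    qed
    moreover have "c u * c v * (\<Sum>j\<in>UNIV. \<bar>b $ j\<bar>) \<le> 2 * K\<^sup>2"
    proof -
      have "(\<Sum>j\<in>UNIV. \<bar>b $ j\<bar>) \<le> (\<Sum>j\<in>UNIV. \<bar>v $ j\<bar> + \<bar>u $ j\<bar>)"
        by (intro sum_mono) (simp add: v)
      then have "c u * c v * (\<Sum>j\<in>UNIV. \<bar>b $ j\<bar>)
          \<le> c u * c v * ((\<Sum>j\<in>UNIV. \<bar>v $ j\<bar>) + (\<Sum>j\<in>UNIV. \<bar>u $ j\<bar>))"
        using cc by (intro mult_left_mono) (auto simp: sum.distrib)
      also have "\<dots> = c u * (c v * (\<Sum>j\<in>UNIV. \<bar>v $ j\<bar>)) + c v * (c u * (\<Sum>j\<in>UNIV. \<bar>u $ j\<bar>))"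
        by (simp add: algebra_simps)
      also have "\<dots> \<le> K * K + K * K"
        using c_le_K c_sum_le u v(1) cc K
        by (intro add_mono mult_mono) (auto intro!: mult_nonneg_nonneg sum_nonneg)
      finally show ?thesis by (simp add: power2_eq_square)
    qed
    ultimately show ?thesis using cc by (intro exI[of _ "c u * c v"]) auto
  next
    case False
    then have "b \<in> Basis" using that B(2) by auto
    then obtain k where k: "b = axis k 1" by (auto simp: Basis_vec_def)
    have "(\<Sum>j\<in>UNIV. \<bar>b $ j\<bar>) = 1"
      by (simp add: k axis_def if_distrib[of abs] cong: if_cong)
    moreover have "1 \<le> K\<^sup>2" using K by simp
    ultimately show ?thesis
      by (intro exI[of _ 1]) (auto simp: k axis_def)
  qed
  then obtain d where d: "\<And>b. b \<in> B - {t} \<Longrightarrow> 0 < d b"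
    "\<And>b j. b \<in> B - {t} \<Longrightarrow> d b * b $ j \<in> \<int>"
    "\<And>b. b \<in> B - {t} \<Longrightarrow> d b * (\<Sum>j\<in>UNIV. \<bar>b $ j\<bar>) \<le> 2 * K\<^sup>2"
    by metis
  \<comment> \<open>Row multipliers. In row \<open>i0\<close> the factor \<open>c u\<close> will be
    bounded by \<open>K\<close>, while \<open>c x\<close> is kept because \<open>c_bound\<close>
    speaks only of points of \<open>V\<close>.\<close>
  define e where "e i = (if i = i0 then c x * c u else d (g i))" for i
  have cc: "1 \<le> c u" "1 \<le> c x" using c_pos u by auto
  have e_pos: "0 < e i" for i
    using cc d(1) gne by (auto simp: e_def)
  define A A' where "A = (\<chi> i. g i)"
    and "A' = (\<chi> i. if i = i0 then row i0 A + (u - y) else row i A)"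
  have rowA: "row i A = g i" for i by (simp add: A_def row_def vec_eq_iff)
  have "rows A = B"
    using g by (auto simp: rows_def rowA bij_betw_def)
  then have detA: "det A \<noteq> 0"
    using det_nonzero_if_span_rows span_B by blast
  \<comment> \<open>Since \<open>t\<close> is not in \<open>W\<close>, all of \<open>W\<close>
    occurs among the other rows. Their span contains \<open>u - y\<close>, which may thus be added
    to row \<open>i0\<close>, turning \<open>x - u\<close> into \<open>x - y\<close>.\<close>
  have "W \<subseteq> {row j A |j. j \<noteq> i0}"
  proof
    fix w assume "w \<in> W"
    then have "w \<in> B" "w \<noteq> t" using B(1) t span_base by auto
    then show "w \<in> {row j A |j. j \<noteq> i0}"
      using g i0 by (auto simp: rowA bij_betw_def)
  qed
  then have "u - y \<in> span {row j A |j. j \<noteq> i0}"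
    using uy span_mono by blast
  then have detA': "det A' = det A"
    unfolding A'_def by (intro det_row_span) (simp add: span_vec_eq)
  have A'_i: "A' $ i = (if i = i0 then x - y else g i)" for i
    by (simp add: A'_def rowA i0 t_def)
  have "e i * g i $ j \<in> \<int>" for i j
  proof (cases "i = i0")
    case True
    have "e i * g i $ j = c u * (c x * x $ j) - c x * (c u * u $ j)"
      by (simp add: True e_def i0 t_def algebra_simps)
    then show ?thesis
      using c_Ints c_mult_Ints u by (simp add: Ints_diff Ints_mult)
  next
    case False
    then show ?thesis using d(2) gne by (simp add: e_def)
  qed
  \<comment> \<open>Integrality is read off the scaled rows of \<open>A\<close>, the size off those
    of \<open>A'\<close>. The scaled \<open>A'\<close> need not be integral, as nothing is known
    about the coordinates of \<open>y\<close>.\<close>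
  then have "det (\<chi> i. e i *s g i) \<in> \<int>"
    by (intro det_Ints) simp
  moreover have det1: "det (\<chi> i. e i *s g i) = (\<Prod>i\<in>UNIV. e i) * det A"
    by (simp add: det_rows_mul A_def)
  moreover have "(\<Prod>i\<in>UNIV. e i) \<noteq> 0"
    using e_pos by (metis finite prod_zero_iff less_irrefl)
  ultimately have "1 \<le> \<bar>(\<Prod>i\<in>UNIV. e i) * det A\<bar>"
    using detA by (intro Ints_nonzero_abs_ge1) auto
  also have "(\<Prod>i\<in>UNIV. e i) * det A = det (\<chi> i. e i *s A' $ i)"
    by (simp add: det_rows_mul detA'[symmetric])
  also have "\<bar>\<dots>\<bar> \<le> (\<Prod>i\<in>UNIV. \<Sum>j\<in>UNIV. \<bar>e i * A' $ i $ j\<bar>)"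
    by (rule order_trans[OF abs_det_le_prod_sum_abs]) simp
  also have "\<dots> = (\<Prod>i\<in>UNIV. e i * (\<Sum>j\<in>UNIV. \<bar>A' $ i $ j\<bar>))"
    using e_pos by (simp add: abs_mult sum_distrib_left less_imp_le)
  also have "\<dots> = (e i0 * (\<Sum>j\<in>UNIV. \<bar>A' $ i0 $ j\<bar>)) *
      (\<Prod>i\<in>UNIV - {i0}. e i * (\<Sum>j\<in>UNIV. \<bar>A' $ i $ j\<bar>))"
    by (rule prod.remove) auto
  also have "\<dots> \<le> (c x * K * (real CARD('n) * dist x y)) * (2 * K\<^sup>2) ^ (CARD('n) - 1)"
  proof (rule mult_mono)
    have "(\<Sum>j\<in>UNIV. \<bar>A' $ i0 $ j\<bar>) \<le> real CARD('n) * dist x y"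
      using sum_bounded_above[of UNIV "\<lambda>j. \<bar>(x - y) $ j\<bar>" "norm (x - y)"]
        component_le_norm_cart[of "x - y"] by (simp add: A'_i dist_norm)
    moreover have "e i0 \<le> c x * K"
      using c_le_K[OF u] cc by (simp add: e_def)
    ultimately show "e i0 * (\<Sum>j\<in>UNIV. \<bar>A' $ i0 $ j\<bar>) \<le> c x * K * (real CARD('n) * dist x y)"
      using cc K by (intro mult_mono) (auto intro: sum_nonneg)
    have "(\<Prod>i\<in>UNIV - {i0}. e i * (\<Sum>j\<in>UNIV. \<bar>A' $ i $ j\<bar>)) \<le> (\<Prod>i\<in>UNIV - {i0}. 2 * K\<^sup>2)"
      using d(3) gne e_pos
      by (intro prod_mono) (auto simp: A'_i e_def less_imp_le
          intro!: mult_nonneg_nonneg sum_nonneg d(1)[THEN less_imp_le])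
    then show "(\<Prod>i\<in>UNIV - {i0}. e i * (\<Sum>j\<in>UNIV. \<bar>A' $ i $ j\<bar>)) \<le> (2 * K\<^sup>2) ^ (CARD('n) - 1)"
      by (simp add: card_Diff_singleton)
    show "0 \<le> c x * K * (real CARD('n) * dist x y)"
      using cc K by simp
    show "0 \<le> (\<Prod>i\<in>UNIV - {i0}. e i * (\<Sum>j\<in>UNIV. \<bar>A' $ i $ j\<bar>))"
      using e_pos by (intro prod_nonneg) (auto intro!: mult_nonneg_nonneg sum_nonneg simp: less_imp_le)
  qed
  finally show ?thesis .
qed

section \<open>Common denominators and encoding lengths\<close>

text \<open>A product instead of the least common multiple, so that it can be estimated coordinate
  by coordinate.\<close>

definition denominator :: "rat ^ 'n \<Rightarrow> int" where
  "denominator v = (\<Prod>j\<in>UNIV. snd (quotient_of (v $ j)))"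

lemma denominator_ge_1: "1 \<le> denominator v"
  unfolding denominator_def
  by (rule prod_ge_1) (use quotient_of_denom_pos' in \<open>simp add: int_one_le_iff_zero_less\<close>)

lemma denominator_0: "denominator 0 = 1"
  by (simp add: denominator_def)

lemma of_rat_eq_quotient:
  "real_of_rat q = of_int (fst (quotient_of q)) / of_int (snd (quotient_of q))"
  using quotient_of_div[of q "fst (quotient_of q)" "snd (quotient_of q)"]
  by (metis of_rat_divide of_rat_of_int_eq prod.collapse)

lemma denominator_mult_Ints: "of_int (denominator v) * real_vec v $ j \<in> \<int>"
proof -
  have "real_of_int (denominator v) * real_vec v $ j =
      of_int (\<Prod>i\<in>UNIV - {j}. snd (quotient_of (v $ i)))
        * (of_int (snd (quotient_of (v $ j))) * of_rat (v $ j))"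
    unfolding denominator_def by (subst prod.remove[of _ j]) (auto simp: real_vec_def)
  also have "of_int (snd (quotient_of (v $ j))) * real_of_rat (v $ j) = of_int (fst (quotient_of (v $ j)))"
    using quotient_of_denom_pos'[of "v $ j"] by (simp add: of_rat_eq_quotient)
  finally show ?thesis by (simp del: of_int_prod)
qed

lemma abs_plus_1_le_enc_int: "\<bar>real_of_int m\<bar> + 1 \<le> 2 powr (of_int (enc_int m) - 1)"
proof -
  have "log 2 (\<bar>real_of_int m\<bar> + 1) \<le> of_int (enc_int m) - 1"
    unfolding enc_int_def by simp
  then show ?thesis by (subst (asm) log_le_iff) auto
qed

text \<open>A coordinate \<open>p / s\<close> contributes \<open>s + \<bar>p\<bar>\<close>, at most
  \<open>(\<bar>p\<bar> + 1) * (s + 1)\<close>. The leading 1 in \<open>enc_int\<close> saves 2 per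
  coordinate in the exponent, and the dimension summand of \<open>enc_vec\<close> saves 1 more,
  whence \<open>3 * CARD('n)\<close>.\<close>

lemma denominator_le_enc_vec:
  fixes v :: "rat ^ 'n"
  shows "of_int (denominator v) * (1 + (\<Sum>j\<in>UNIV. \<bar>real_vec v $ j\<bar>))
    \<le> 2 powr (of_int (enc_vec v) - 3 * real CARD('n))"
proof -
  define p s where "p j = fst (quotient_of (v $ j))" and "s j = snd (quotient_of (v $ j))" for j
  have s: "1 \<le> real_of_int (s j)" for j
    using quotient_of_denom_pos'[of "v $ j"] by (simp add: s_def int_one_le_iff_zero_less)
  have vj: "real_vec v $ j = of_int (p j) / of_int (s j)" for j
    by (simp add: real_vec_def p_def s_def of_rat_eq_quotient)
  have "of_int (denominator v) * (1 + (\<Sum>j\<in>UNIV. \<bar>real_vec v $ j\<bar>))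
      \<le> of_int (denominator v) * (\<Prod>j\<in>UNIV. 1 + \<bar>real_vec v $ j\<bar>)"
    using denominator_ge_1[of v] by (intro mult_left_mono one_plus_sum_le_prod) auto
  also have "\<dots> = (\<Prod>j\<in>UNIV. of_int (s j) * (1 + \<bar>real_vec v $ j\<bar>))"
    by (simp add: denominator_def prod.distrib s_def)
  also have "\<dots> \<le> (\<Prod>j\<in>UNIV. 2 powr (of_int (enc_rat (v $ j)) - 2))"
  proof (rule prod_mono, intro conjI)
    fix j
    show "0 \<le> of_int (s j) * (1 + \<bar>real_vec v $ j\<bar>)"
      using s[of j] by simp
    have "of_int (s j) * (1 + \<bar>real_vec v $ j\<bar>) = of_int (s j) + \<bar>real_of_int (p j)\<bar>"
      using s[of j] by (simp add: vj algebra_simps)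
    also have "\<dots> \<le> (\<bar>real_of_int (p j)\<bar> + 1) * (\<bar>real_of_int (s j)\<bar> + 1)"
      using s[of j] by (simp add: algebra_simps)
    also have "\<dots> \<le> 2 powr (of_int (enc_int (p j)) - 1) * 2 powr (of_int (enc_int (s j)) - 1)"
      by (intro mult_mono abs_plus_1_le_enc_int) auto
    also have "\<dots> = 2 powr (of_int (enc_rat (v $ j)) - 2)"
      by (simp add: powr_add[symmetric] enc_rat_def p_def s_def split: prod.split)
    finally show "of_int (s j) * (1 + \<bar>real_vec v $ j\<bar>) \<le> 2 powr (of_int (enc_rat (v $ j)) - 2)" .
  qed
  also have "\<dots> = 2 powr (\<Sum>j\<in>UNIV. of_int (enc_rat (v $ j)) - 2)"
    by (simp add: powr_sum)
  also have "(\<Sum>j\<in>UNIV. real_of_int (enc_rat (v $ j)) - 2) = of_int (enc_vec v) - 3 * real CARD('n)"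
    by (simp add: enc_vec_def sum_subtractf)
  finally show ?thesis .
qed

lemma log_denominator_le: "log 2 (of_int (denominator v)) \<le> of_int (enc_vec v) - 3 * real CARD('n)"
  for v :: "rat ^ 'n"
proof -
  have D: "1 \<le> real_of_int (denominator v)" using denominator_ge_1[of v] by simp
  then have "real_of_int (denominator v) * 1
      \<le> of_int (denominator v) * (1 + (\<Sum>j\<in>UNIV. \<bar>real_vec v $ j\<bar>))"
    by (intro mult_left_mono) (auto intro: sum_nonneg)
  then have "of_int (denominator v) \<le> 2 powr (of_int (enc_vec v) - 3 * real CARD('n))"
    using denominator_le_enc_vec[of v] by simp
  then show ?thesis using D by (subst log_le_iff) auto
qed

lemma enc_vec_nonneg: "0 \<le> enc_vec v"
proof -
  have "0 \<le> log 2 (real_of_int (denominator v))"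
    using denominator_ge_1[of v] by simp
  then have "0 \<le> real_of_int (enc_vec v)"
    using log_denominator_le[of v] by linarith
  then show ?thesis by simp
qed

lemma real_vec_inject: "real_vec v = real_vec w \<longleftrightarrow> v = w"
  by (simp add: real_vec_def vec_eq_iff)

section \<open>Logarithms and the final bounds\<close>

text \<open>The left-hand side bounds the logarithm of
  \<open>K * n * (2 * K\<^sup>2) ^ (n - 1)\<close> when \<open>log 2 K = \<phi> - 3 * n\<close>,
  using \<open>log 2 n \<le> n\<close>. It equals \<open>(2 * n - 1) * (\<phi> + 1 - 3 * n)\<close>;
  the two products are estimated separately.\<close>

lemma exponent_estimate:
  fixes n \<phi> :: real
  assumes n: "1 \<le> n" and "0 \<le> \<phi>"
  shows "(\<phi> - 3 * n) + n + (n - 1) * (1 + 2 * (\<phi> - 3 * n)) \<le> 3 * n\<^sup>2 * \<phi> - n"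
proof -
  have "n * 1 \<le> n * n" using n by (intro mult_left_mono) auto
  then have "(2 * n - 1) * \<phi> \<le> 3 * n\<^sup>2 * \<phi>"
    using n \<open>0 \<le> \<phi>\<close> unfolding power2_eq_square by (intro mult_right_mono) linarith+
  moreover have "(2 * n - 1) * (1 - 3 * n) \<le> 1 * (1 - 3 * n)"
    using n by (intro mult_right_mono_neg) linarith+
  ultimately show ?thesis using n by (simp add: algebra_simps)
qed

text \<open>Common source of both claims: the encoding of \<theta> enters only through its
  denominator.\<close>

lemma log_inverse_rel_radius_le:
  fixes \<Omega> :: "(rat ^ 'n) set" and \<theta> :: "rat ^ 'n" and \<phi> :: int
  assumes "2 \<le> card \<Omega>" and \<phi>: "\<And>v. v \<in> \<Omega> \<Longrightarrow> enc_vec v \<le> \<phi>"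
    and \<theta>: "real_vec \<theta> \<in> rel_interior (convex hull (real_vec ` \<Omega>))"
  shows "log 2 (1 / rel_radius (real_vec ` \<Omega>) (real_vec \<theta>))
    \<le> log 2 (of_int (denominator \<theta>)) + 3 * (real CARD('n))\<^sup>2 * of_int \<phi> - real CARD('n)"
proof -
  let ?n = "real CARD('n)"
  have fin: "finite \<Omega>" using assms(1) by (metis card.infinite not_numeral_le_zero)
  have "2 \<le> card (real_vec ` \<Omega>)"
    using assms(1) by (subst card_image) (auto simp: inj_on_def real_vec_inject)
  then obtain y where y: "y \<in> rel_frontier (convex hull (real_vec ` \<Omega>))"
    and r: "rel_radius (real_vec ` \<Omega>) (real_vec \<theta>) = dist (real_vec \<theta>) y"
    using rel_radius_eq_dist_rel_frontier[OF finite_imageI[OF fin] _ \<theta>] by blast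
  obtain V where V: "V \<subseteq> real_vec ` \<Omega>" "y \<in> affine hull V" "real_vec \<theta> \<notin> affine hull V"
    using rel_frontier_convex_hull_finite[OF finite_imageI[OF fin] y \<theta>] .
  \<comment> \<open>The multipliers must be a function on real vectors; as \<open>real_vec\<close>
    is injective, its inverse recovers the rational vector at every point where \<open>c\<close> is
    evaluated.\<close>
  define c where "c v = real_of_int (denominator (inv real_vec v))" for v :: "real ^ 'n"
  have inv: "inv real_vec (real_vec v) = v" for v :: "rat ^ 'n"
    by (intro inv_f_f) (simp add: inj_def real_vec_inject)
  define K where "K = 2 powr (of_int \<phi> - 3 * ?n)"
  have "1 \<le> c (real_vec \<theta>) * K * (?n * dist (real_vec \<theta>) y) * (2 * K\<^sup>2) ^ (CARD('n) - 1)"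
  proof (rule dist_affine_hull_lower_bound[OF V(2,3)])
    fix v assume "v \<in> insert (real_vec \<theta>) V"
    then obtain w where "v = real_vec w" using V(1) by auto
    then show "1 \<le> c v" "c v \<in> \<int>" "c v * v $ j \<in> \<int>" for j
      using denominator_ge_1[of w] denominator_mult_Ints[of w] by (auto simp: c_def inv)
  next
    fix v assume "v \<in> V"
    then obtain w where w: "w \<in> \<Omega>" "v = real_vec w" using V(1) by auto
    have "c v * (1 + (\<Sum>j\<in>UNIV. \<bar>v $ j\<bar>)) \<le> 2 powr (of_int (enc_vec w) - 3 * ?n)"
      using denominator_le_enc_vec[of w] by (simp add: w c_def inv)
    also have "\<dots> \<le> K"
      unfolding K_def using \<phi>[OF w(1)] by (intro powr_mono) auto
    finally show "c v * (1 + (\<Sum>j\<in>UNIV. \<bar>v $ j\<bar>)) \<le> K" .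
  qed
  moreover define D where "D = real_of_int (denominator \<theta>)"
  moreover define r where "r = dist (real_vec \<theta>) y"
  ultimately have ineq: "1 \<le> D * K * (?n * r) * (2 * K\<^sup>2) ^ (CARD('n) - 1)"
    by (simp add: c_def inv)
  have n: "1 \<le> ?n" by simp
  have D: "1 \<le> D" unfolding D_def using denominator_ge_1[of \<theta>] by simp
  have K: "0 < K" by (simp add: K_def)
  \<comment> \<open>For \<open>r = 0\<close> the right-hand side of \<open>ineq\<close> would
    vanish. Positivity is what allows the logarithm of the product to be split.\<close>
  have rpos: "0 < r"
    using ineq by (cases "r = 0") (auto simp: r_def)
  have logK: "log 2 K = of_int \<phi> - 3 * ?n" by (simp add: K_def)
  have "0 \<le> log 2 (D * K * (?n * r) * (2 * K\<^sup>2) ^ (CARD('n) - 1))"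
    using ineq by simp
  also have "\<dots> = log 2 D + log 2 K + log 2 ?n + log 2 r + (?n - 1) * (1 + 2 * log 2 K)"
    using D K rpos n by (simp add: log_mult log_nat_power of_nat_diff algebra_simps)
  finally have "- log 2 r \<le> log 2 D + log 2 K + log 2 ?n + (?n - 1) * (1 + 2 * log 2 K)"
    by simp
  moreover have "log 2 ?n \<le> ?n"
    using less_exp[of "CARD('n)"]
    by (subst log_le_iff) (auto simp: powr_realpow less_imp_le simp flip: of_nat_power)
  ultimately have "- log 2 r \<le> log 2 D + (of_int \<phi> - 3 * ?n) + ?n
      + (?n - 1) * (1 + 2 * (of_int \<phi> - 3 * ?n))"
    by (simp add: logK)
  moreover have "0 \<le> \<phi>"
  proof -
    obtain w where "w \<in> \<Omega>" using assms(1) by fastforce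
    then show ?thesis using enc_vec_nonneg[of w] \<phi>[of w] by simp
  qed
  then have "(of_int \<phi> - 3 * ?n) + ?n + (?n - 1) * (1 + 2 * (of_int \<phi> - 3 * ?n))
      \<le> 3 * ?n\<^sup>2 * of_int \<phi> - ?n"
    using n by (intro exponent_estimate) auto
  ultimately have "- log 2 r \<le> log 2 D + 3 * ?n\<^sup>2 * of_int \<phi> - ?n" by linarith
  then show ?thesis
    using rpos by (simp add: r D_def r_def log_divide)
qed

theorem lemma4p1:
  fixes \<omega> :: "nat \<Rightarrow> rat ^ 'n"
    and k :: nat
    and \<Omega> :: "(rat ^ 'n) set"
    and \<theta> :: "rat ^ 'n"
  assumes "\<Omega> = \<omega> ` {1..k}"
    and "2 \<le> card \<Omega>"
    and "real_vec \<theta> \<in> rel_interior (convex hull (real_vec ` \<Omega>))"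
  shows "log 2 (1 / rel_radius (real_vec ` \<Omega>) (real_vec \<theta>))
           \<le> of_int (6 * (int CARD('n))\<^sup>2 * (MAX i\<in>{1..k}. enc_vec (\<omega> i))
                      + enc_vec \<theta> - int CARD('n))
         \<and> (\<theta> = 0 \<longrightarrow>
             log 2 (1 / rel_radius (real_vec ` \<Omega>) (real_vec \<theta>))
               \<le> of_int (3 * (int CARD('n))\<^sup>2 * (MAX i\<in>{1..k}. enc_vec (\<omega> i))
                          - int CARD('n)))"
proof -
  define \<phi> where "\<phi> = (MAX i\<in>{1..k}. enc_vec (\<omega> i))"
  let ?n = "real CARD('n)" and ?L = "log 2 (1 / rel_radius (real_vec ` \<Omega>) (real_vec \<theta>))"
  have le_\<phi>: "enc_vec v \<le> \<phi>" if "v \<in> \<Omega>" for v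
    using that unfolding \<phi>_def assms(1) by (auto intro!: Max_ge)
  have bound: "?L \<le> log 2 (of_int (denominator \<theta>)) + 3 * ?n\<^sup>2 * of_int \<phi> - ?n"
    using assms(2) le_\<phi> assms(3) by (rule log_inverse_rel_radius_le)
  obtain w where "w \<in> \<Omega>" using assms(2) by fastforce
  then have "0 \<le> \<phi>" using enc_vec_nonneg[of w] le_\<phi>[of w] by simp
  \<comment> \<open>This pads the coefficient 3 of \<open>bound\<close> to the stated 6; the
    logarithm of the denominator is absorbed by \<open>enc_vec \<theta>\<close>.\<close>
  then have "0 \<le> ?n\<^sup>2 * of_int \<phi>" by simp
  moreover have "log 2 (of_int (denominator \<theta>)) \<le> of_int (enc_vec \<theta>)"
    using log_denominator_le[of \<theta>] by simp
  ultimately have "?L \<le> of_int (6 * (int CARD('n))\<^sup>2 * \<phi> + enc_vec \<theta> - int CARD('n))"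
    using bound by simp
  \<comment> \<open>The zero vector has denominator 1, whose logarithm vanishes.\<close>
  moreover have "?L \<le> of_int (3 * (int CARD('n))\<^sup>2 * \<phi> - int CARD('n))" if "\<theta> = 0"
    using bound by (simp add: that denominator_0)
  ultimately show ?thesis by (simp add: \<phi>_def)
qed

end
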